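(* Let $\mathcal L$ be a positive definite linear functional on $\prod^{N,M}$ with vector orthonormal polynomials $\{\Phi_{n,m}\}$, $\{\tilde\Phi_{n,m}\}$ as in the context. For $1\le n\le N$, $1\le m\le M$ and all $z,w,z_1,w_1\in\mathbb{C}$, $$\Phi_{n,m}(z,w)^T\overline{\Phi_{n,m}(z_1,w_1)}-\Phi_{n,m-1}(z,w)^T\overline{\Phi_{n,m-1}(z_1,w_1)}=\tilde\Phi_{n,m}(z,w)^T\overline{\tilde\Phi_{n,m}(z_1,w_1)}-\tilde\Phi_{n-1,m}(z,w)^T\overline{\tilde\Phi_{n-1,m}(z_1,w_1)}.$$
   Context: $\prod^{N,M}=\mathrm{span}\{z^iw^j:|i|\le N,|j|\le M\}$, $\hat\prod^{N,M}=\mathrm{span}\{z^iw^j:0\le i\le N,0\le j\le M\}$. A linear functional $\mathcal L$ on $\prod^{N,M}$ with $\mathcal L(z^{-i}w^{-j})=\overline{\mathcal L(z^iw^j)}$ is positive definite if $\langle p,p\rangle>0$ for all nonzero $p\in\hat\prod^{N,M}$, where $\langle p,q\rangle=\mathcal L\big(p(z,w)\,\overline{q(1/\bar z,1/\bar w)}\big)$. For $0\le l\le m$, $\phi^l_{n,m}$ is the unique element of $\mathrm{span}(\{z^iw^j:0\le i<n,0\le j\le m\}\cup\{z^nw^j:0\le j\le l\})$ with positive coefficient of $z^nw^l$, $\langle\phi^l_{n,m},\phi^l_{n,m}\rangle=1$, orthogonal to all of these monomials except $z^nw^l$; $\Phi_{n,m}=[\phi^m_{n,m},\dots,\phi^0_{n,m}]^T$.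 For $0\le l\le n$, $\tilde\phi^l_{n,m}$ is the unique element of $\mathrm{span}(\{z^iw^j:0\le i\le n,0\le j<m\}\cup\{z^iw^m:0\le i\le l\})$ with positive coefficient of $z^lw^m$, norm one, orthogonal to all of these monomials except $z^lw^m$; $\tilde\Phi_{n,m}=[\tilde\phi^n_{n,m},\dots,\tilde\phi^0_{n,m}]^T$. $\overline{\Phi(z_1,w_1)}$ is the entrywise conjugate of the value at $(z_1,w_1)$. *)

theory Defs
  imports
    Jordan_Normal_Form.Matrix
    "HOL-Library.Poly_Mapping"
    "HOL-Library.Product_Plus"
begin

text \<open>
  Laurent polynomials in \<open>z, w\<close> are finitely supported maps from exponent pairs to coefficients;
  the product on \<open>\<Rightarrow>\<^sub>0\<close> is convolution, hence multiplication of Laurent polynomials.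
\<close>
type_synonym laurent = "(int \<times> int) \<Rightarrow>\<^sub>0 complex"

definition lmon :: "int \<Rightarrow> int \<Rightarrow> laurent" where
  "lmon i j = Poly_Mapping.single (i, j) 1"

definition lscale :: "complex \<Rightarrow> laurent \<Rightarrow> laurent" where
  "lscale c p = Poly_Mapping.map ((*) c) p"

lemma lookup_lscale [simp]:
  "Poly_Mapping.lookup (lscale c p) k = c * Poly_Mapping.lookup p k"
  by (simp add: lscale_def Poly_Mapping.map.rep_eq when_def)

interpretation laurent: vector_space lscale
  by unfold_locales (auto intro!: poly_mapping_eqI simp: lookup_add algebra_simps)

text \<open>
  Evaluation uses \<open>0 powi 0 = 1\<close>, so for nonnegative exponents it is the usual evaluation at every
  point of \<open>\<complex>\<^sup>2\<close>; negative exponents are meaningful at nonzero arguments only.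
\<close>
definition leval :: "laurent \<Rightarrow> complex \<Rightarrow> complex \<Rightarrow> complex" where
  "leval p z w =
     (\<Sum>(i, j) \<in> Poly_Mapping.keys p. Poly_Mapping.lookup p (i, j) * z powi i * w powi j)"

text \<open>
  The Laurent polynomial that takes the value \<open>cnj (q (1 / cnj z) (1 / cnj w))\<close> at nonzero
  \<open>z, w\<close> (see \<open>leval_lstar\<close>): coefficients are conjugated and exponents negated.
\<close>
definition lstar :: "laurent \<Rightarrow> laurent" where
  "lstar q = Poly_Mapping.map_key uminus (Poly_Mapping.map cnj q)"

lemma lookup_lstar [simp]:
  "Poly_Mapping.lookup (lstar q) k = cnj (Poly_Mapping.lookup q (- k))"
  by (simp add: lstar_def Poly_Mapping.map_key.rep_eq Poly_Mapping.map.rep_eq when_def)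

lemma leval_lstar:
  assumes "z \<noteq> 0" "w \<noteq> 0"
  shows "leval (lstar q) z w = cnj (leval q (1 / cnj z) (1 / cnj w))"
proof -
  have powi: "x powi (- i) = (1 / x) powi i" for x :: complex and i
    by (simp add: power_int_minus power_int_divide_distrib divide_inverse power_int_inverse)
  have keys: "Poly_Mapping.keys (lstar q) = uminus ` Poly_Mapping.keys q"
    by (force simp: in_keys_iff image_iff intro: minus_minus[symmetric])
  show ?thesis
    unfolding leval_def keys
    by (subst sum.reindex) (auto simp: powi case_prod_unfold uminus_prod_def intro!: sum.cong)
qed

definition Lpolys :: "nat \<Rightarrow> nat \<Rightarrow> laurent set" where
  "Lpolys N M = laurent.span {lmon i j |i j. \<bar>i\<bar> \<le> int N \<and> \<bar>j\<bar> \<le> int M}"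

definition polys :: "nat \<Rightarrow> nat \<Rightarrow> laurent set" where
  "polys N M = laurent.span {lmon i j |i j. 0 \<le> i \<and> i \<le> int N \<and> 0 \<le> j \<and> j \<le> int M}"

text \<open>
  A functional on \<open>Lpolys N M\<close> is a total function of which only the values on \<open>Lpolys N M\<close> are
  constrained.
\<close>
definition linear_functional :: "nat \<Rightarrow> nat \<Rightarrow> (laurent \<Rightarrow> complex) \<Rightarrow> bool" where
  "linear_functional N M L \<longleftrightarrow>
     (\<forall>p \<in> Lpolys N M. \<forall>q \<in> Lpolys N M. L (p + q) = L p + L q) \<and>
     (\<forall>c. \<forall>p \<in> Lpolys N M. L (lscale c p) = c * L p)"

definition hermitian_functional :: "nat \<Rightarrow> nat \<Rightarrow> (laurent \<Rightarrow> complex) \<Rightarrow> bool" where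
  "hermitian_functional N M L \<longleftrightarrow>
     (\<forall>i j. \<bar>i\<bar> \<le> int N \<longrightarrow> \<bar>j\<bar> \<le> int M \<longrightarrow> L (lmon (- i) (- j)) = cnj (L (lmon i j)))"

definition lip :: "(laurent \<Rightarrow> complex) \<Rightarrow> laurent \<Rightarrow> laurent \<Rightarrow> complex" where
  "lip L p q = L (p * lstar q)"

text \<open>
  Here and below \<open>0 < c\<close> for complex \<open>c\<close> is the order of \<open>Complex_Order\<close>: \<open>c\<close> is real and positive.
\<close>
definition positive_definite :: "nat \<Rightarrow> nat \<Rightarrow> (laurent \<Rightarrow> complex) \<Rightarrow> bool" where
  "positive_definite N M L \<longleftrightarrow> (\<forall>p \<in> polys N M. p \<noteq> 0 \<longrightarrow> 0 < lip L p p)"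

text \<open>
  The normalized element of the span of the monomials with exponents in \<open>S\<close> that is orthogonal to
  all of them except the one with exponent \<open>k\<close>.
\<close>
definition is_orthonormal_poly ::
  "(laurent \<Rightarrow> complex) \<Rightarrow> (int \<times> int) set \<Rightarrow> int \<times> int \<Rightarrow> laurent \<Rightarrow> bool" where
  "is_orthonormal_poly L S k p \<longleftrightarrow>
     p \<in> laurent.span ((\<lambda>(i, j). lmon i j) ` S) \<and>
     0 < Poly_Mapping.lookup p k \<and>
     lip L p p = 1 \<and>
     (\<forall>(i, j) \<in> S - {k}. lip L p (lmon i j) = 0)"

definition phi :: "(laurent \<Rightarrow> complex) \<Rightarrow> nat \<Rightarrow> nat \<Rightarrow> nat \<Rightarrow> laurent" where
  "phi L n m l = (THE p. is_orthonormal_poly L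
     ({0..<int n} \<times> {0..int m} \<union> {int n} \<times> {0..int l}) (int n, int l) p)"

definition phi_tilde :: "(laurent \<Rightarrow> complex) \<Rightarrow> nat \<Rightarrow> nat \<Rightarrow> nat \<Rightarrow> laurent" where
  "phi_tilde L n m l = (THE p. is_orthonormal_poly L
     ({0..int n} \<times> {0..<int m} \<union> {0..int l} \<times> {int m}) (int l, int m) p)"

definition Phi :: "(laurent \<Rightarrow> complex) \<Rightarrow> nat \<Rightarrow> nat \<Rightarrow> laurent vec" where
  "Phi L n m = vec (m + 1) (\<lambda>k. phi L n m (m - k))"

definition Phi_tilde :: "(laurent \<Rightarrow> complex) \<Rightarrow> nat \<Rightarrow> nat \<Rightarrow> laurent vec" where
  "Phi_tilde L n m = vec (n + 1) (\<lambda>k. phi_tilde L n m (n - k))"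

definition vleval :: "laurent vec \<Rightarrow> complex \<Rightarrow> complex \<Rightarrow> complex vec" where
  "vleval V z w = map_vec (\<lambda>p. leval p z w) V"

end

theory Submission
  imports Defs
begin

text \<open>
  Write \<open>K\<^bsub>n,m\<^esub>\<close> for the reproducing kernel of \<open>polys n m\<close>. Adjoining one exponent to the spanning
  monomials adds the rank-one term \<open>p(z,w) \<cdot> cnj (p(z1,w1))\<close> of the corresponding orthonormal
  polynomial to the kernel. Passing from \<open>polys (n - 1) m\<close> to \<open>polys n m\<close> along the column \<open>z\<^sup>n w\<^sup>l\<close>
  gives \<open>\<Phi>\<^bsub>n,m\<^esub>\<^sup>T \<Phi>\<^bsub>n,m\<^esub> = K\<^bsub>n,m\<^esub> - K\<^bsub>n-1,m\<^esub>\<close> (second factor conjugated), and along rows similarly for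
  the other family, so that both sides equal \<open>K\<^bsub>n,m\<^esub> - K\<^bsub>n-1,m\<^esub> - K\<^bsub>n,m-1\<^esub> + K\<^bsub>n-1,m-1\<^esub>\<close>.
\<close>

section \<open>Algebra of \<open>lstar\<close>, scaling and evaluation\<close>

lemma lstar_add: "lstar (p + q) = lstar p + lstar q"
  by (rule poly_mapping_eqI) (simp add: lookup_add)

lemma lstar_lscale: "lstar (lscale c p) = lscale (cnj c) (lstar p)"
  by (rule poly_mapping_eqI) simp

lemma lstar_lmon: "lstar (lmon i j) = lmon (- i) (- j)"
  by (rule poly_mapping_eqI) (auto simp: lmon_def lookup_single when_def uminus_prod_def)

lemma lscale_eq_single_mult: "lscale c p = Poly_Mapping.single 0 c * p"
  by (simp add: lscale_def mult_map_scale_conv_mult)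

lemma lscale_mult_left: "lscale c p * q = lscale c (p * q)"
  by (simp add: lscale_eq_single_mult mult.assoc)

lemma lscale_mult_right: "p * lscale c q = lscale c (p * q)"
  by (metis lscale_mult_left mult.commute)

lemma lmon_mult: "lmon i j * lmon i' j' = lmon (i + i') (j + j')"
  by (simp add: lmon_def mult_single)

lemma leval_eq_sum:
  assumes "finite A" "Poly_Mapping.keys p \<subseteq> A"
  shows "leval p z w = (\<Sum>(i, j) \<in> A. Poly_Mapping.lookup p (i, j) * z powi i * w powi j)"
  unfolding leval_def using assms
  by (intro sum.mono_neutral_left) (auto simp: in_keys_iff)

lemma leval_add: "leval (p + q) z w = leval p z w + leval q z w"
proof -
  let ?A = "Poly_Mapping.keys p \<union> Poly_Mapping.keys q"
  have "leval f z w = (\<Sum>(i, j) \<in> ?A. Poly_Mapping.lookup f (i, j) * z powi i * w powi j)"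
    if "f \<in> {p, q, p + q}" for f
    using that keys_add[of p q] by (intro leval_eq_sum) auto
  then show ?thesis
    by (simp add: lookup_add algebra_simps sum.distrib case_prod_unfold)
qed

lemma leval_lscale: "leval (lscale c p) z w = c * leval p z w"
proof -
  have "leval (lscale c p) z w =
      (\<Sum>(i, j) \<in> Poly_Mapping.keys p. Poly_Mapping.lookup (lscale c p) (i, j) * z powi i * w powi j)"
    by (intro leval_eq_sum) (auto simp: in_keys_iff)
  then show ?thesis
    by (simp add: leval_def sum_distrib_left mult.assoc case_prod_unfold)
qed

lemma leval_sum: "leval (sum f A) z w = (\<Sum>x\<in>A. leval (f x) z w)"
  by (induction A rule: infinite_finite_induct) (auto simp: leval_add leval_def[of 0])

section \<open>Spans of monomials and linear forms on them\<close>

abbreviation lspan :: "(int \<times> int) set \<Rightarrow> laurent set" where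
  "lspan S \<equiv> laurent.span ((\<lambda>(i, j). lmon i j) ` S)"

lemma lookup_lspan_outside:
  assumes "p \<in> lspan S" "k \<notin> S"
  shows "Poly_Mapping.lookup p k = 0"
  using assms(1)
proof (induction rule: laurent.span_induct_alt)
  case base
  then show ?case by simp
next
  case (step c x y)
  then show ?case
    using assms(2) by (auto simp: lookup_add lmon_def lookup_single when_def split: if_splits)
qed

text \<open>Modulo \<open>lspan S\<close>, \<open>p\<close> is a multiple of the monomial at
  \<open>k\<close>, and for \<open>k\<close> outside \<open>S\<close> the coefficient at
  \<open>k\<close> reads off the factor. Cancelling a leading coefficient thus moves a polynomial
  into the smaller span.\<close>

lemma lspan_insert_lookup_0:
  assumes "p \<in> lspan (insert k S)" "Poly_Mapping.lookup p k = 0"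
  shows "p \<in> lspan S"
proof (cases "k \<in> S")
  case True
  then show ?thesis using assms(1) by (simp add: insert_absorb)
next
  case False
  obtain i j where k: "k = (i, j)" by force
  from assms(1) obtain c where c: "p - lscale c (lmon i j) \<in> lspan S"
    unfolding k by (auto simp: laurent.span_breakdown_eq)
  then have "Poly_Mapping.lookup (p - lscale c (lmon i j)) k = 0"
    using False by (rule lookup_lspan_outside)
  then have "c = 0"
    using assms(2) k by (simp add: lookup_minus lmon_def)
  then show ?thesis using c by simp
qed

text \<open>Linearity is relative to \<open>V\<close> because \<open>L\<close> is constrained only
  on \<open>Lpolys N M\<close>: forms such as \<open>\<lambda>q. lip L q x\<close> are known to be
  linear only on \<open>polys N M\<close>.\<close>

definition linear_form :: "laurent set \<Rightarrow> (laurent \<Rightarrow> complex) \<Rightarrow> bool" where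
  "linear_form V e \<longleftrightarrow>
     (\<forall>p\<in>V. \<forall>q\<in>V. e (p + q) = e p + e q) \<and> (\<forall>c. \<forall>p\<in>V. e (lscale c p) = c * e p)"

lemma linear_form_leval: "linear_form V (\<lambda>p. leval p z w)"
  by (simp add: linear_form_def leval_add leval_lscale)

text \<open>\<open>r\<close> is the Riesz representer of \<open>e\<close> on \<open>lspan S\<close>.
  For \<open>e\<close> the evaluation at \<open>(z1, w1)\<close> it is the reproducing kernel with
  its second point frozen, as a polynomial in \<open>z, w\<close>.\<close>

definition represents ::
  "(laurent \<Rightarrow> complex) \<Rightarrow> (int \<times> int) set \<Rightarrow> (laurent \<Rightarrow> complex) \<Rightarrow> laurent \<Rightarrow> bool" where
  "represents L S e r \<longleftrightarrow> r \<in> lspan S \<and> (\<forall>q\<in>lspan S. lip L q r = e q)"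

section \<open>The sesquilinear form \<open>lip L\<close> on \<open>polys N M\<close>\<close>

locale positive_definite_functional =
  fixes N M :: nat and L :: "laurent \<Rightarrow> complex"
  assumes lin: "linear_functional N M L"
    and herm: "hermitian_functional N M L"
    and pos: "positive_definite N M L"
begin

abbreviation box :: "(int \<times> int) set" where
  "box \<equiv> {0..int N} \<times> {0..int M}"

lemma polys_eq_lspan: "polys N M = lspan box"
  unfolding polys_def by (rule arg_cong[of _ _ laurent.span]) (force simp: image_iff)

lemma lspan_subset_polys: "S \<subseteq> box \<Longrightarrow> lspan S \<subseteq> polys N M"
  unfolding polys_eq_lspan by (intro laurent.span_mono image_mono)

lemma lmon_in_polys: "(i, j) \<in> box \<Longrightarrow> lmon i j \<in> polys N M"
  unfolding polys_def by (intro laurent.span_base) auto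

lemma polys_add: "p \<in> polys N M \<Longrightarrow> q \<in> polys N M \<Longrightarrow> p + q \<in> polys N M"
  unfolding polys_def by (rule laurent.span_add)

lemma polys_diff: "p \<in> polys N M \<Longrightarrow> q \<in> polys N M \<Longrightarrow> p - q \<in> polys N M"
  unfolding polys_def by (rule laurent.span_diff)

lemma polys_lscale: "p \<in> polys N M \<Longrightarrow> lscale c p \<in> polys N M"
  unfolding polys_def by (rule laurent.span_scale)

lemma polys_0: "0 \<in> polys N M"
  unfolding polys_def by (rule laurent.span_zero)

text \<open>Linearity of \<open>L\<close> is guarded by membership, so the step supplies
  \<open>q \<in> polys N M\<close>; the proof carries it along in a conjunction.\<close>

lemma polys_induct [consumes 1, case_names zero step]:
  assumes "p \<in> polys N M"
    and "P 0"
    and "\<And>c i j q. (i, j) \<in> box \<Longrightarrow> q \<in> polys N M \<Longrightarrow> P q \<Longrightarrow> P (lscale c (lmon i j) + q)"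
  shows "P p"
proof -
  have "p \<in> polys N M \<and> P p"
    using assms(1) unfolding polys_eq_lspan
  proof (induction rule: laurent.span_induct_alt)
    case base
    then show ?case using assms(2) by (simp add: laurent.span_zero)
  next
    case (step c x y)
    then show ?case
      using assms(3)[of _ _ y c] unfolding polys_eq_lspan
      by (auto intro!: laurent.span_add laurent.span_scale intro: laurent.span_base)
  qed
  then show ?thesis ..
qed

text \<open>Exponents of the product are differences of two points of \<open>box\<close>, hence
  bounded by \<open>N\<close> and \<open>M\<close> in absolute value. This licenses the
  sesquilinearity of \<open>lip L\<close> below.\<close>

lemma mult_lstar_in_Lpolys:
  assumes "p \<in> polys N M" "q \<in> polys N M"
  shows "p * lstar q \<in> Lpolys N M"
  using assms(1)
proof (induction rule: polys_induct)
  case zero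
  then show ?case by (simp add: Lpolys_def laurent.span_zero)
next
  case (step c i j p')
  from assms(2) have "lmon i j * lstar q \<in> Lpolys N M"
  proof (induction rule: polys_induct)
    case zero
    have "lstar 0 = 0" by (rule poly_mapping_eqI) simp
    then show ?case by (simp add: Lpolys_def laurent.span_zero)
  next
    case (step c' i' j' q')
    have "lmon (i - i') (j - j') \<in> Lpolys N M"
      unfolding Lpolys_def using step(1) \<open>(i, j) \<in> box\<close>
      by (intro laurent.span_base) (auto intro!: exI)
    then show ?case
      using step(3) unfolding Lpolys_def
      by (simp add: lstar_add lstar_lscale lstar_lmon ring_distribs lscale_mult_right lmon_mult
          laurent.span_add laurent.span_scale)
  qed
  then show ?case
    using step(3) unfolding Lpolys_def
    by (simp add: ring_distribs lscale_mult_left laurent.span_add laurent.span_scale)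
qed

lemma lip_add_left:
  "\<lbrakk>p \<in> polys N M; q \<in> polys N M; r \<in> polys N M\<rbrakk> \<Longrightarrow> lip L (p + q) r = lip L p r + lip L q r"
  using lin by (simp add: lip_def linear_functional_def ring_distribs mult_lstar_in_Lpolys)

lemma lip_add_right:
  "\<lbrakk>p \<in> polys N M; q \<in> polys N M; r \<in> polys N M\<rbrakk> \<Longrightarrow> lip L r (p + q) = lip L r p + lip L r q"
  using lin by (simp add: lip_def linear_functional_def lstar_add ring_distribs mult_lstar_in_Lpolys)

lemma lip_lscale_left:
  "\<lbrakk>p \<in> polys N M; r \<in> polys N M\<rbrakk> \<Longrightarrow> lip L (lscale c p) r = c * lip L p r"
  using lin by (simp add: lip_def linear_functional_def lscale_mult_left mult_lstar_in_Lpolys)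

lemma lip_lscale_right:
  "\<lbrakk>p \<in> polys N M; r \<in> polys N M\<rbrakk> \<Longrightarrow> lip L r (lscale c p) = cnj c * lip L r p"
  using lin
  by (simp add: lip_def linear_functional_def lstar_lscale lscale_mult_right mult_lstar_in_Lpolys)

lemma lip_0_left: "p \<in> polys N M \<Longrightarrow> lip L 0 p = 0"
  using lip_lscale_left[of p p 0] by simp

lemma lip_0_right: "p \<in> polys N M \<Longrightarrow> lip L p 0 = 0"
  using lip_lscale_right[of p p 0] by simp

lemma lip_diff_left:
  "\<lbrakk>p \<in> polys N M; q \<in> polys N M; r \<in> polys N M\<rbrakk> \<Longrightarrow> lip L (p - q) r = lip L p r - lip L q r"
  using lip_add_left[of "p - q" q r] by (simp add: polys_diff)

lemma lip_diff_right:
  "\<lbrakk>p \<in> polys N M; q \<in> polys N M; r \<in> polys N M\<rbrakk> \<Longrightarrow> lip L r (p - q) = lip L r p - lip L r q"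
  using lip_add_right[of "p - q" q r] by (simp add: polys_diff)

text \<open>Sesquilinearity and a nested induction reduce the claim to two monomials, where it is
  the hermitian symmetry of the moments of \<open>L\<close>.\<close>

lemma lip_cnj:
  assumes "p \<in> polys N M" "q \<in> polys N M"
  shows "lip L q p = cnj (lip L p q)"
  using assms(1)
proof (induction rule: polys_induct)
  case zero
  then show ?case using assms(2) by (simp add: lip_0_left lip_0_right)
next
  case (step c i j p')
  note ij = lmon_in_polys[OF step(1)]
  from assms(2) have "lip L q (lmon i j) = cnj (lip L (lmon i j) q)"
  proof (induction rule: polys_induct)
    case zero
    then show ?case using ij by (simp add: lip_0_left lip_0_right)
  next
    case (step c' i' j' q')
    have "L (lmon (- (i - i')) (- (j - j'))) = cnj (L (lmon (i - i') (j - j')))"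
      using herm step(1) \<open>(i, j) \<in> box\<close>
      by (auto simp: hermitian_functional_def simp del: minus_diff_eq)
    then have "lip L (lmon i' j') (lmon i j) = cnj (lip L (lmon i j) (lmon i' j'))"
      by (simp add: lip_def lstar_lmon lmon_mult)
    then show ?case
      using step ij lmon_in_polys[OF step(1)]
      by (simp add: lip_add_left lip_add_right lip_lscale_left lip_lscale_right polys_lscale)
  qed
  then show ?case
    using step ij assms(2)
    by (simp add: lip_add_left lip_add_right lip_lscale_left lip_lscale_right polys_lscale)
qed

lemma lip_pos: "p \<in> polys N M \<Longrightarrow> p \<noteq> 0 \<Longrightarrow> 0 < lip L p p"
  using pos by (auto simp: positive_definite_def)

lemma lip_self_eq_0: "p \<in> polys N M \<Longrightarrow> lip L p p = 0 \<Longrightarrow> p = 0"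
  using lip_pos by force

lemma orthogonal_lspan:
  assumes "p \<in> polys N M" "S \<subseteq> box" "\<forall>(i, j)\<in>S. lip L p (lmon i j) = 0" "q \<in> lspan S"
  shows "lip L p q = 0"
proof -
  have "q \<in> polys N M \<and> lip L p q = 0"
    using assms(4)
  proof (induction rule: laurent.span_induct_alt)
    case base
    then show ?case using assms(1) by (simp add: lip_0_right polys_0)
  next
    case (step c x y)
    then obtain i j where x: "x = lmon i j" and ij: "(i, j) \<in> S" by auto
    have "x \<in> polys N M" using ij assms(2) x by (auto intro: lmon_in_polys)
    moreover have "lip L p x = 0" using ij assms(3) x by blast
    ultimately show ?case
      using step assms(1) by (simp add: lip_add_right lip_lscale_right polys_add polys_lscale)
  qed
  then show ?thesis ..
qed

text \<open>The difference of two representers lies in \<open>lspan S\<close>; pairing it with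
  either of them gives the same value of \<open>e\<close>, so it is orthogonal to itself and
  vanishes by definiteness.\<close>

lemma represents_unique:
  assumes "S \<subseteq> box" "represents L S e r" "represents L S e r'"
  shows "r = r'"
proof -
  have r: "r \<in> lspan S" "r' \<in> lspan S" using assms by (auto simp: represents_def)
  then have P: "r \<in> polys N M" "r' \<in> polys N M" using lspan_subset_polys[OF assms(1)] by auto
  have d: "r - r' \<in> lspan S" using r by (rule laurent.span_diff)
  then have "lip L (r - r') (r - r') = e (r - r') - e (r - r')"
    using assms(2,3) P by (simp add: represents_def lip_diff_right polys_diff)
  then show ?thesis using lip_self_eq_0[of "r - r'"] P by (simp add: polys_diff)
qed

section \<open>Adjoining one exponent: updated representers, uniqueness and existence of the
  orthonormal polynomial\<close>

context
  fixes S k p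
  assumes sub: "insert k S \<subseteq> box" and k: "k \<notin> S"
    and p: "is_orthonormal_poly L (insert k S) k p"
begin

lemma orthonormal_poly_facts:
  shows "p \<in> lspan (insert k S)" "p \<in> polys N M" "Poly_Mapping.lookup p k \<noteq> 0"
    "q \<in> lspan S \<Longrightarrow> lip L p q = 0"
proof -
  show 1: "p \<in> lspan (insert k S)" using p by (simp add: is_orthonormal_poly_def)
  then show 2: "p \<in> polys N M" using lspan_subset_polys[OF sub] by auto
  show "Poly_Mapping.lookup p k \<noteq> 0" using p by (auto simp: is_orthonormal_poly_def)
  show "lip L p q = 0" if "q \<in> lspan S"
    using orthogonal_lspan[OF 2 _ _ that] p sub k by (auto simp: is_orthonormal_poly_def)
qed

text \<open>\<open>p\<close> is a unit vector orthogonal to \<open>lspan S\<close>, so the added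
  multiple leaves pairings with \<open>lspan S\<close> unchanged and raises the pairing with
  \<open>p\<close> from 0 to \<open>e p\<close>. The coefficient is conjugated because
  \<open>lip L\<close> is conjugate linear in its second argument.\<close>

lemma represents_insert:
  assumes e: "linear_form (polys N M) e" and r: "represents L S e r"
  shows "represents L (insert k S) e (r + lscale (cnj (e p)) p)"
proof -
  note f = orthonormal_poly_facts
  have rS: "r \<in> lspan S" using r by (simp add: represents_def)
  have sub': "lspan S \<subseteq> polys N M" "lspan S \<subseteq> lspan (insert k S)"
    using sub by (auto intro!: lspan_subset_polys laurent.span_mono)
  have rP: "r \<in> polys N M" using sub' rS by auto
  have "lip L q (r + lscale (cnj (e p)) p) = e q" if q: "q \<in> lspan (insert k S)" for q
  proof -
    \<comment> \<open>\<open>a\<close> cancels the coefficient at \<open>k\<close>, so that the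
      remainder \<open>q0\<close> falls into \<open>lspan S\<close>.\<close>
    define a where "a = Poly_Mapping.lookup q k / Poly_Mapping.lookup p k"
    define q0 where "q0 = q - lscale a p"
    have "q0 \<in> lspan (insert k S)"
      unfolding q0_def using q f(1) by (intro laurent.span_diff laurent.span_scale)
    moreover have "Poly_Mapping.lookup q0 k = 0"
      using f(3) by (simp add: q0_def a_def lookup_minus)
    ultimately have q0: "q0 \<in> lspan S" by (rule lspan_insert_lookup_0)
    have q0P: "q0 \<in> polys N M" using q0 sub' by auto
    have eq: "q = q0 + lscale a p" by (simp add: q0_def)
    have "lip L q0 r = e q0" using r q0 by (simp add: represents_def)
    moreover have "lip L q0 p = 0" using f(4)[OF q0] lip_cnj[OF f(2) q0P] by simp
    moreover have "lip L p r = 0" by (rule f(4)[OF rS])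
    moreover have "lip L p p = 1" using p by (simp add: is_orthonormal_poly_def)
    moreover have "e q = e q0 + a * e p"
      using e q0P f(2) unfolding eq by (simp add: linear_form_def polys_lscale)
    ultimately show ?thesis
      unfolding eq using q0P f(2) rP
      by (simp add: lip_add_left lip_add_right lip_lscale_left lip_lscale_right polys_lscale polys_add)
  qed
  moreover have "r + lscale (cnj (e p)) p \<in> lspan (insert k S)"
    using rS sub' f(1) by (intro laurent.span_add laurent.span_scale) auto
  ultimately show ?thesis by (simp add: represents_def)
qed

text \<open>Each candidate, multiplied by the other's leading coefficient, differs from the other by
  an element of \<open>lspan S\<close>, to which both are orthogonal; so the difference is zero and
  they are proportional. Unit norms give the leading coefficients equal moduli, and positivity makes
  them equal.\<close>

lemma orthonormal_poly_unique:
  assumes p': "is_orthonormal_poly L (insert k S) k p'"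
  shows "p' = p"
proof -
  define a b where "a = Poly_Mapping.lookup p k" and "b = Poly_Mapping.lookup p' k"
  have ab: "0 < a" "0 < b" using p p' by (auto simp: a_def b_def is_orthonormal_poly_def)
  have p'f: "p' \<in> lspan (insert k S)" using p' by (simp add: is_orthonormal_poly_def)
  then have p'P: "p' \<in> polys N M" using lspan_subset_polys[OF sub] by auto
  note f = orthonormal_poly_facts
  define d where "d = lscale b p - lscale a p'"
  have "d \<in> lspan (insert k S)"
    unfolding d_def using f(1) p'f by (intro laurent.span_diff laurent.span_scale)
  then have d: "d \<in> lspan S"
    by (rule lspan_insert_lookup_0) (simp add: d_def lookup_minus a_def b_def)
  have dP: "d \<in> polys N M" unfolding d_def using f(2) p'P by (intro polys_diff polys_lscale)
  have "lip L p d = 0" by (rule f(4)[OF d])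
  moreover have "lip L p' d = 0"
    using orthogonal_lspan[OF p'P _ _ d] p' sub k by (auto simp: is_orthonormal_poly_def)
  moreover have "lip L d d = b * lip L p d - a * lip L p' d"
    using f(2) p'P dP by (subst (1) d_def) (simp add: lip_diff_left lip_lscale_left polys_lscale)
  ultimately have "d = 0" using lip_self_eq_0 dP by simp
  then have eq: "lscale b p = lscale a p'" by (simp add: d_def)
  have "b * cnj b * lip L p p = lip L (lscale b p) (lscale b p)"
    using f(2) by (simp add: lip_lscale_left lip_lscale_right polys_lscale)
  also have "\<dots> = a * cnj a * lip L p' p'"
    using p'P by (simp add: eq lip_lscale_left lip_lscale_right polys_lscale)
  finally have "b * cnj b = a * cnj a" using p p' by (simp add: is_orthonormal_poly_def)
  then have "cmod b = cmod a"
    by (metis complex_mod_mult_cnj power2_eq_iff_nonneg norm_ge_zero)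
  \<comment> \<open>A complex number above 0 in this order is real, hence equal to its
    modulus.\<close>
  moreover have "b = cmod b" "a = cmod a"
    using ab by (auto simp: less_complex_def complex_eq_iff cmod_def)
  ultimately have "b = a" by simp
  then show ?thesis
    using eq ab by (metis laurent.scale_left_imp_eq laurent.scale_cancel_left less_irrefl)
qed

end

text \<open>A Gram-Schmidt step: subtract from the monomial \<open>x\<close> at \<open>k\<close> its
  projection onto \<open>lspan S\<close> and normalize. The projection is the representer of
  \<open>\<lambda>q. lip L q x\<close>, obtained from the representability assumption
  \<open>ex\<close>.\<close>

lemma orthonormal_poly_exists:
  assumes sub: "insert k S \<subseteq> box" and k: "k \<notin> S"
    and ex: "\<And>e. linear_form (polys N M) e \<Longrightarrow> \<exists>r. represents L S e r"
  shows "\<exists>p. is_orthonormal_poly L (insert k S) k p"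
proof -
  define x where "x = lmon (fst k) (snd k)"
  have xP: "x \<in> polys N M" unfolding x_def using sub by (intro lmon_in_polys) auto
  then have "linear_form (polys N M) (\<lambda>q. lip L q x)"
    by (simp add: linear_form_def lip_add_left lip_lscale_left)
  then obtain r where r: "r \<in> lspan S" "\<And>q. q \<in> lspan S \<Longrightarrow> lip L q r = lip L q x"
    using ex unfolding represents_def by blast
  have sub': "lspan S \<subseteq> polys N M" "lspan S \<subseteq> lspan (insert k S)"
    using sub by (auto intro!: lspan_subset_polys laurent.span_mono)
  define v where "v = x - r"
  have rP: "r \<in> polys N M" using r sub' by auto
  then have vP: "v \<in> polys N M" unfolding v_def using xP by (intro polys_diff)
  have "x \<in> lspan (insert k S)" unfolding x_def by (intro laurent.span_base) (auto simp: case_prod_unfold)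
  then have vS: "v \<in> lspan (insert k S)" unfolding v_def using r sub' by (auto intro: laurent.span_diff)
  \<comment> \<open>\<open>r\<close> has no term at \<open>k\<close>. The coefficient 1 shows
    \<open>v \<noteq> 0\<close> and keeps the leading coefficient positive under the positive
    scaling by \<open>c\<close>.\<close>
  have lv: "Poly_Mapping.lookup v k = 1"
    using lookup_lspan_outside[OF r(1) k] by (simp add: v_def x_def lookup_minus lmon_def)
  then have "v \<noteq> 0" by auto
  then have "0 < lip L v v" using lip_pos vP by auto
  then obtain t where t: "t > 0" "lip L v v = complex_of_real t"
    by (metis less_complex_def complex_is_Real_iff zero_complex.sel of_real_Re)
  define c where "c = complex_of_real (1 / sqrt t)"
  have c: "0 < c" "c * cnj c * complex_of_real t = 1"
    using t by (auto simp: c_def less_complex_def simp flip: of_real_mult)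
  have "lip L (lscale c v) (lmon i j) = 0" if "(i, j) \<in> S" for i j
  proof -
    have m: "lmon i j \<in> lspan S" using that by (intro laurent.span_base) force
    then have mP: "lmon i j \<in> polys N M" using sub' by auto
    have "lip L (lmon i j) v = 0"
      unfolding v_def using r(2)[OF m] mP rP xP by (simp add: lip_diff_right)
    then have "lip L v (lmon i j) = 0" using lip_cnj[OF mP vP] by simp
    then show ?thesis using vP mP by (simp add: lip_lscale_left)
  qed
  then have "is_orthonormal_poly L (insert k S) k (lscale c v)"
    using c vP t lv vS
    by (auto simp: is_orthonormal_poly_def lip_lscale_left lip_lscale_right polys_lscale
        mult.assoc mult.left_commute laurent.span_scale)
  then show ?thesis ..
qed

text \<open>Representability on \<open>S\<close> yields the orthonormal polynomial for a new
  exponent \<open>k\<close>, which in turn yields representability on \<open>insert k S\<close>. The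
  induction generalizes \<open>e\<close>, since the first half uses a form other than the given
  one.\<close>

lemma represents_exists:
  assumes "finite S" "S \<subseteq> box" "linear_form (polys N M) e"
  shows "\<exists>r. represents L S e r"
  using assms
proof (induction S arbitrary: e rule: finite_induct)
  case empty
  have "e 0 = 0"
    using empty(2) polys_0 laurent.scale_zero_left by (metis linear_form_def mult_zero_left)
  then show ?case
    by (intro exI[of _ 0]) (simp add: represents_def lip_0_left polys_0)
next
  case (insert k S)
  then obtain p where "is_orthonormal_poly L (insert k S) k p"
    using orthonormal_poly_exists[of k S] by auto
  moreover obtain r where "represents L S e r" using insert by auto
  ultimately show ?case using represents_insert insert by blast
qed

text \<open>Existence and uniqueness together make the definite descriptions behind
  \<open>phi\<close> and \<open>phi_tilde\<close> meaningful.\<close>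

lemma the_orthonormal_poly:
  assumes "insert k S \<subseteq> box" "k \<notin> S"
  shows "is_orthonormal_poly L (insert k S) k (THE p. is_orthonormal_poly L (insert k S) k p)"
proof -
  have "finite S" using assms(1) by (auto intro: finite_subset[of _ box])
  then obtain p where "is_orthonormal_poly L (insert k S) k p"
    using orthonormal_poly_exists represents_exists assms by (metis insert_subset)
  then show ?thesis using orthonormal_poly_unique[OF assms] by (metis theI)
qed

section \<open>Filling a whole column or row, one exponent at a time\<close>

lemma represents_chain:
  fixes S :: "nat \<Rightarrow> (int \<times> int) set"
  assumes "\<And>l. l < d \<Longrightarrow> S (Suc l) = insert (k l) (S l) \<and> k l \<notin> S l"
    and "S d \<subseteq> box" "linear_form (polys N M) e" "represents L (S 0) e r"
    and p: "\<And>l. l < d \<Longrightarrow> p l = (THE p. is_orthonormal_poly L (S (Suc l)) (k l) p)"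
  shows "represents L (S d) e (r + (\<Sum>l<d. lscale (cnj (e (p l))) (p l)))"
  using assms
proof (induction d)
  case 0
  then show ?case by simp
next
  case (Suc d)
  have S: "S (Suc d) = insert (k d) (S d)" "k d \<notin> S d" using Suc.prems(1) by auto
  then have sub: "insert (k d) (S d) \<subseteq> box" using Suc.prems(2) by simp
  have r: "represents L (S d) e (r + (\<Sum>l<d. lscale (cnj (e (p l))) (p l)))"
    using Suc sub by auto
  have "is_orthonormal_poly L (insert (k d) (S d)) (k d) (p d)"
    using the_orthonormal_poly[OF sub S(2)] S Suc.prems(5) by simp
  from represents_insert[OF sub S(2) this Suc.prems(3) r] show ?case
    by (simp only: S(1) sum.lessThan_Suc add.assoc)
qed

lemma represents_Phi:
  assumes "1 \<le> n" "n \<le> N" "m \<le> M" and e: "linear_form (polys N M) e"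
    and r: "represents L ({0..int (n - 1)} \<times> {0..int m}) e r"
  shows "represents L ({0..int n} \<times> {0..int m}) e
    (r + (\<Sum>l<Suc m. lscale (cnj (e (phi L n m l))) (phi L n m l)))"
proof -
  \<comment> \<open>The half-open range in the last column makes \<open>S 0\<close> the smaller
    rectangle and \<open>S (Suc l)\<close> exactly the index set in the definition of
    \<open>phi L n m l\<close>.\<close>
  define S where "S l = {0..<int n} \<times> {0..int m} \<union> {int n} \<times> {0..<int l}" for l
  have S0: "S 0 = {0..int (n - 1)} \<times> {0..int m}" using assms(1) by (auto simp: S_def)
  have S1: "S (Suc m) = {0..int n} \<times> {0..int m}" by (auto simp: S_def)
  have SS: "S (Suc l) = {0..<int n} \<times> {0..int m} \<union> {int n} \<times> {0..int l}" for l
    by (auto simp: S_def)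
  have "represents L (S (Suc m)) e
    (r + (\<Sum>l<Suc m. lscale (cnj (e (phi L n m l))) (phi L n m l)))"
  proof (rule represents_chain[where k = "\<lambda>l. (int n, int l)"])
    show "S (Suc l) = insert (int n, int l) (S l) \<and> (int n, int l) \<notin> S l" for l
      by (auto simp: S_def)
    show "S (Suc m) \<subseteq> box" using assms by (auto simp: S1)
    show "represents L (S 0) e r" using r by (simp add: S0)
  qed (use e in \<open>simp_all add: phi_def SS\<close>)
  then show ?thesis by (simp only: S1)
qed

lemma represents_Phi_tilde:
  assumes "1 \<le> m" "n \<le> N" "m \<le> M" and e: "linear_form (polys N M) e"
    and r: "represents L ({0..int n} \<times> {0..int (m - 1)}) e r"
  shows "represents L ({0..int n} \<times> {0..int m}) e
    (r + (\<Sum>l<Suc n. lscale (cnj (e (phi_tilde L n m l))) (phi_tilde L n m l)))"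
proof -
  \<comment> \<open>The same filling along the top row, with \<open>S (Suc l)\<close> the index set
    of \<open>phi_tilde L n m l\<close>.\<close>
  define S where "S l = {0..int n} \<times> {0..<int m} \<union> {0..<int l} \<times> {int m}" for l
  have S0: "S 0 = {0..int n} \<times> {0..int (m - 1)}" using assms(1) by (auto simp: S_def)
  have S1: "S (Suc n) = {0..int n} \<times> {0..int m}" by (auto simp: S_def)
  have SS: "S (Suc l) = {0..int n} \<times> {0..<int m} \<union> {0..int l} \<times> {int m}" for l
    by (auto simp: S_def)
  have "represents L (S (Suc n)) e
    (r + (\<Sum>l<Suc n. lscale (cnj (e (phi_tilde L n m l))) (phi_tilde L n m l)))"
  proof (rule represents_chain[where k = "\<lambda>l. (int l, int m)"])
    show "S (Suc l) = insert (int l, int m) (S l) \<and> (int l, int m) \<notin> S l" for l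
      by (auto simp: S_def)
    show "S (Suc n) \<subseteq> box" using assms by (auto simp: S1)
    show "represents L (S 0) e r" using r by (simp add: S0)
  qed (use e in \<open>simp_all add: phi_tilde_def SS\<close>)
  then show ?thesis by (simp only: S1)
qed

end

section \<open>Scalar products of values, and the final identity\<close>

lemma vleval_scalar_prod:
  "vleval (vec (d + 1) (\<lambda>k. f (d - k))) z w \<bullet> conjugate (vleval (vec (d + 1) (\<lambda>k. f (d - k))) z1 w1)
    = leval (\<Sum>l<Suc d. lscale (cnj (leval (f l) z1 w1)) (f l)) z w"
proof -
  \<comment> \<open>The vectors list the polynomials by decreasing index; reversing the sum matches
    the order of the filling.\<close>
  have "(\<Sum>k<Suc d. leval (f (d - k)) z w * cnj (leval (f (d - k)) z1 w1))
      = (\<Sum>l<Suc d. leval (f l) z w * cnj (leval (f l) z1 w1))"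
    using sum.nat_diff_reindex[of "\<lambda>l. leval (f l) z w * cnj (leval (f l) z1 w1)" "Suc d"] by simp
  then show ?thesis
    by (simp add: scalar_prod_def vleval_def leval_sum leval_lscale mult.commute
        atLeast0LessThan del: sum.lessThan_Suc)
qed

theorem lemma4p3:
  fixes L :: "laurent \<Rightarrow> complex" and N M n m :: nat and z w z1 w1 :: complex
  assumes "linear_functional N M L"
    and "hermitian_functional N M L"
    and "positive_definite N M L"
    and "1 \<le> n" and "n \<le> N" and "1 \<le> m" and "m \<le> M"
  shows "vleval (Phi L n m) z w \<bullet> conjugate (vleval (Phi L n m) z1 w1)
       - vleval (Phi L n (m - 1)) z w \<bullet> conjugate (vleval (Phi L n (m - 1)) z1 w1)
       = vleval (Phi_tilde L n m) z w \<bullet> conjugate (vleval (Phi_tilde L n m) z1 w1)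
       - vleval (Phi_tilde L (n - 1) m) z w \<bullet> conjugate (vleval (Phi_tilde L (n - 1) m) z1 w1)"
proof -
  interpret positive_definite_functional N M L
    using assms(1-3) by unfold_locales
  \<comment> \<open>Freezing the second point turns the kernel identity into an equation of
    polynomials in \<open>z, w\<close>. Evaluation is linear at every point, including those with a
    zero coordinate.\<close>
  define e where "e p = leval p z1 w1" for p
  have e: "linear_form (polys N M) e"
    unfolding e_def by (rule linear_form_leval)
  define B where "B a b = {0..int a} \<times> {0..int b}" for a b
  have B: "B a b \<subseteq> box" if "a \<le> N" "b \<le> M" for a b
    using that by (auto simp: B_def)
  define s where "s a b = (\<Sum>l<Suc b. lscale (cnj (e (phi L a b l))) (phi L a b l))" for a b
  define t where
    "t a b = (\<Sum>l<Suc a. lscale (cnj (e (phi_tilde L a b l))) (phi_tilde L a b l))" for a b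
  have "\<exists>r. represents L (B (n - 1) (m - 1)) e r"
    by (rule represents_exists[OF _ B e]) (use assms in \<open>auto simp: B_def\<close>)
  then obtain r where r: "represents L (B (n - 1) (m - 1)) e r" ..
  \<comment> \<open>First path from \<open>B (n - 1) (m - 1)\<close> to \<open>B n m\<close>: add
    the column \<open>n\<close> up to height \<open>m - 1\<close>, then the full row
    \<open>m\<close>.\<close>
  have "represents L (B n (m - 1)) e (r + s n (m - 1))"
    using represents_Phi[of n "m - 1" e r] assms e r by (simp add: B_def s_def)
  then have 1: "represents L (B n m) e (r + s n (m - 1) + t n m)"
    using represents_Phi_tilde[of m n e] assms e by (simp add: B_def t_def)
  \<comment> \<open>Second path: add the row \<open>m\<close> up to \<open>n - 1\<close>, then the
    full column \<open>n\<close>.\<close>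
  have "represents L (B (n - 1) m) e (r + t (n - 1) m)"
    using represents_Phi_tilde[of m "n - 1" e r] assms e r by (simp add: B_def t_def)
  then have 2: "represents L (B n m) e (r + t (n - 1) m + s n m)"
    using represents_Phi[of n m e] assms e by (simp add: B_def s_def)
  \<comment> \<open>Both paths reach a representer on the same rectangle; the common
    \<open>r\<close> cancels after evaluation at \<open>(z, w)\<close>.\<close>
  have "r + s n (m - 1) + t n m = r + t (n - 1) m + s n m"
    using B 1 2 assms by (blast intro: represents_unique)
  then have "leval (s n (m - 1)) z w + leval (t n m) z w = leval (t (n - 1) m) z w + leval (s n m) z w"
    by (metis add.assoc add_left_cancel leval_add)
  then show ?thesis
    unfolding Phi_def Phi_tilde_def vleval_scalar_prod
    unfolding s_def t_def e_def by (simp add: algebra_simps)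
qed

end
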